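(* For any $c\in\mathbb{Q}\cap(0,\frac12]$ and any $0<p<1$ the random $c$-Lüroth transformation $L_{c,p}$ is Markov.
   Context: Let $T_L:[0,1]\to[0,1]$ be given by $T_L(0)=0$, $T_L(1)=1$ and $T_L(x)=\lceil \frac1x\rceil(\lceil \frac1x\rceil-1)x-(\lceil \frac1x\rceil-1)$ for $x\ne 0,1$, and let $T_A=1-T_L$. For $c\in(0,\frac12]$ put $z_n=\frac1n$ ($n\ge1$), $z_n^+=z_n+cz_nz_{n-1}$ ($n\ge 2$), $z_n^-=z_n-cz_nz_{n+1}$ ($n\ge1$). Define $T_{0,c},T_{1,c}:[c,1]\to[c,1]$ by: $T_{0,c}(x)=T_A(x)$ if $x\in\bigcup_{n\ge2}[z_n,z_n^+)$ and $T_{0,c}(x)=T_L(x)$ if $x\in\{1\}\cup\bigcup_{n\ge2}[z_n^+,z_{n-1})$; $T_{1,c}(x)=T_A(x)$ if $x\in\bigcup_{n\ge2}[z_n,z_{n-1}^-]$ and $T_{1,c}(x)=T_L(x)$ if $x\in\{1\}\cup\bigcup_{n\ge2}(z_{n-1}^-,z_{n-1})$. The random $c$-Lüroth transformation is $L_{c,p}(\omega,x)=(\sigma(\omega),T_{\omega_1,c}(x))$ on $\{0,1\}^{\mathbb N}\times[c,1]$, where $\sigma$ is the left shift and $T_{0,c}$, $T_{1,c}$ are applied with probabilities $p$ and $1-p$ respectively. $L_{c,p}$ is Markov if there is a finite set of points $c=a_0<a_1<\cdots<a_N=1$ such that for each $j\in\{0,1\}$ and each $0\le i<N$ the map $T_{j,c}$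 is affine (and non-constant) on the open interval $(a_i,a_{i+1})$ and $T_{j,c}((a_i,a_{i+1}))$ is an open interval with endpoints in $\{a_0,\ldots,a_N\}$ (so it is, up to finitely many points, a union of intervals of the partition). Such a set of points is said to give a Markov partition for $L_{c,p}$. *)

theory Defs
  imports Complex_Main
begin

definition T_L :: "real \<Rightarrow> real" where
  "T_L x = (if x = 0 then 0 else if x = 1 then 1
            else of_int \<lceil>1 / x\<rceil> * (of_int \<lceil>1 / x\<rceil> - 1) * x - (of_int \<lceil>1 / x\<rceil> - 1))"

definition T_A :: "real \<Rightarrow> real" where
  "T_A x = 1 - T_L x"

definition z :: "nat \<Rightarrow> real" where
  "z n = 1 / real n"

text \<open>\<open>z_plus\<close> is only used for \<open>n \<ge> 2\<close> and \<open>z_minus\<close> only for \<open>n \<ge> 1\<close>.\<close>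

definition z_plus :: "real \<Rightarrow> nat \<Rightarrow> real" where
  "z_plus c n = z n + c * z n * z (n - 1)"

definition z_minus :: "real \<Rightarrow> nat \<Rightarrow> real" where
  "z_minus c n = z n - c * z n * z (n + 1)"

text \<open>For \<open>0 < c \<le> 1/2\<close> the two cases below are disjoint and cover \<open>(0,1]\<close>, hence the domain
  \<open>[c,1]\<close>; the value \<open>undefined\<close> is only taken outside of it.\<close>

definition T_0 :: "real \<Rightarrow> real \<Rightarrow> real" where
  "T_0 c x =
    (if x \<in> (\<Union>n\<in>{2..}. {z n..<z_plus c n}) then T_A x
     else if x \<in> {1} \<union> (\<Union>n\<in>{2..}. {z_plus c n..<z (n - 1)}) then T_L x
     else undefined)"

definition T_1 :: "real \<Rightarrow> real \<Rightarrow> real" where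
  "T_1 c x =
    (if x \<in> (\<Union>n\<in>{2..}. {z n..z_minus c (n - 1)}) then T_A x
     else if x \<in> {1} \<union> (\<Union>n\<in>{2..}. {z_minus c (n - 1)<..<z (n - 1)}) then T_L x
     else undefined)"

text \<open>A random transformation of the interval \<open>[lower, upper]\<close> with digits in \<open>{0,1}\<close>: the map
  \<open>fibre j\<close> is applied with probability \<open>weight j\<close>. The associated skew product acts on pairs
  of a digit sequence and a point; the digit written \<open>\<omega>\<^sub>1\<close> in the mathematics is \<open>\<omega> 0\<close> here.\<close>

record random_transformation =
  lower :: real
  upper :: real
  fibre :: "nat \<Rightarrow> real \<Rightarrow> real"
  weight :: "nat \<Rightarrow> real"

definition skew_product ::
    "random_transformation \<Rightarrow> (nat \<Rightarrow> nat) \<times> real \<Rightarrow> (nat \<Rightarrow> nat) \<times> real" where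
  "skew_product R = (\<lambda>(\<omega>, x). (\<lambda>n. \<omega> (Suc n), fibre R (\<omega> 0) x))"

definition random_luroth :: "real \<Rightarrow> real \<Rightarrow> random_transformation" where
  "random_luroth c p =
    \<lparr>lower = c, upper = 1,
     fibre = (\<lambda>j. if j = 0 then T_0 c else T_1 c),
     weight = (\<lambda>j. if j = 0 then p else 1 - p)\<rparr>"

text \<open>The points \<open>a 0 < \<dots> < a N\<close> give a Markov partition. This is a condition on the two
  fibre maps; the weights do not enter.\<close>

definition markov_partition :: "random_transformation \<Rightarrow> nat \<Rightarrow> (nat \<Rightarrow> real) \<Rightarrow> bool" where
  "markov_partition R N a \<longleftrightarrow>
     a 0 = lower R \<and> a N = upper R \<and> (\<forall>i<N. a i < a (Suc i)) \<and>
     (\<forall>j\<in>{0,1}. \<forall>i<N.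
        (\<exists>m q. m \<noteq> 0 \<and> (\<forall>x\<in>{a i<..<a (Suc i)}. fibre R j x = m * x + q)) \<and>
        (\<exists>u\<in>a ` {0..N}. \<exists>v\<in>a ` {0..N}. u < v \<and> fibre R j ` {a i<..<a (Suc i)} = {u<..<v}))"

definition markov :: "random_transformation \<Rightarrow> bool" where
  "markov R \<longleftrightarrow> (\<exists>N a. markov_partition R N a)"

end

theory Submission
  imports Defs
begin

text \<open>Write \<open>c = a / b\<close> and take as partition points all multiples of \<open>1 / M\<close> in \<open>[c,1]\<close>, where
  \<open>M = b * b!\<close>. Every branch of the two maps has integer coefficients, hence maps multiples of
  \<open>1 / M\<close> to multiples of \<open>1 / M\<close>. The branch endpoints \<open>1 / n\<close>, \<open>z\<^sub>n\<^sup>+\<close> and \<open>z\<^sub>n\<^sub>-\<^sub>1\<^sup>-\<close> that matter on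
  \<open>[c,1]\<close> have \<open>n \<le> b\<close>, so they are themselves multiples of \<open>1 / M\<close> and no partition interval
  contains one of them in its interior.\<close>

section \<open>Affine branches and their values at the endpoints\<close>

text \<open>The affine formula of \<open>T_L\<close> on \<open>{z n..<z (n - 1)}\<close>, extended
  to the whole line so that it can be evaluated at the right endpoint, where \<open>T_L\<close> may
  jump.\<close>

definition branch :: "nat \<Rightarrow> real \<Rightarrow> real" where
  "branch n x = real n * (real n - 1) * x - (real n - 1)"

lemma branch_strict_mono:
  assumes "2 \<le> n"
  shows "strict_mono (branch n)"
  using assms by (intro strict_monoI) (simp add: branch_def)

lemma branch_le_iff: "2 \<le> n \<Longrightarrow> branch n x \<le> branch n y \<longleftrightarrow> x \<le> y"
  by (simp add: branch_strict_mono strict_mono_less_eq)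

lemma branch_less_iff: "2 \<le> n \<Longrightarrow> branch n x < branch n y \<longleftrightarrow> x < y"
  by (simp add: branch_strict_mono strict_mono_less)

text \<open>Since \<open>branch n\<close> is increasing, these values turn comparisons with a branch
  endpoint or switching point into comparisons with 0, 1, \<open>c\<close> and
  \<open>1 - c\<close>.\<close>

lemma branch_endpoints:
  assumes "2 \<le> n"
  shows "branch n (z n) = 0" "branch n (z (n - 1)) = 1"
    "branch n (z_plus c n) = c" "branch n (z_minus c (n - 1)) = 1 - c"
proof -
  \<comment> \<open>The slope of \<open>branch n\<close> is the reciprocal of
    \<open>z n * z (n - 1)\<close>, so it scales the offset in \<open>z_plus\<close> and
    \<open>z_minus\<close> to exactly \<open>c\<close>.\<close>
  define s where "s = real n * (real n - 1)"
  have z: "s * z n = real n - 1" "s * z (n - 1) = real n" "s * (c * z n * z (n - 1)) = c"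
    using assms by (simp_all add: s_def z_def of_nat_diff)
  have b: "branch n x = s * x - (real n - 1)" for x
    by (simp add: branch_def s_def)
  have m: "z_minus c (n - 1) = z (n - 1) - c * z n * z (n - 1)"
    using assms by (simp add: z_minus_def)
  show "branch n (z n) = 0" "branch n (z (n - 1)) = 1"
    "branch n (z_plus c n) = c" "branch n (z_minus c (n - 1)) = 1 - c"
    unfolding b m z_plus_def distrib_left right_diff_distrib z by simp_all
qed

section \<open>The fibre maps in terms of branches\<close>

lemma ceiling_inverse_eq:
  assumes "2 \<le> n" "z n \<le> x" "x < z (n - 1)"
  shows "\<lceil>1 / x\<rceil> = int n"
proof -
  have "0 < x"
    using assms by (auto simp: z_def intro: less_le_trans[of 0 "1 / real n" x])
  then show ?thesis
    using assms by (auto simp: z_def of_nat_diff field_simps intro!: ceiling_unique)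
qed

lemma T_L_eq_branch:
  assumes "2 \<le> n" "z n \<le> x" "x < z (n - 1)"
  shows "T_L x = branch n x"
proof -
  \<comment> \<open>These bounds exclude the special values of \<open>T_L\<close> at 0 and
    1.\<close>
  have "0 < z n" "z (n - 1) \<le> 1"
    using assms(1) by (auto simp: z_def)
  then show ?thesis
    using assms ceiling_inverse_eq[OF assms] by (auto simp: T_L_def branch_def)
qed

lemma z_le_z_plus:
  assumes "2 \<le> n" "0 \<le> c" "c \<le> 1"
  shows "z n \<le> z_plus c n" "z_plus c n \<le> z (n - 1)"
proof -
  have "branch n (z n) \<le> branch n (z_plus c n)" "branch n (z_plus c n) \<le> branch n (z (n - 1))"
    using branch_endpoints[OF assms(1)] assms by auto
  then show "z n \<le> z_plus c n" "z_plus c n \<le> z (n - 1)"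
    using assms(1) by (simp_all add: branch_le_iff)
qed

text \<open>The strict inequality lets the closed piece \<open>{z m..z_minus c (m - 1)}\<close> fit
  into the half-open interval \<open>{z m..<z (m - 1)}\<close>.\<close>

lemma z_le_z_minus:
  assumes "2 \<le> n" "0 < c" "c \<le> 1"
  shows "z n \<le> z_minus c (n - 1)" "z_minus c (n - 1) < z (n - 1)"
proof -
  have "branch n (z n) \<le> branch n (z_minus c (n - 1))"
    "branch n (z_minus c (n - 1)) < branch n (z (n - 1))"
    using branch_endpoints[OF assms(1)] assms by auto
  then show "z n \<le> z_minus c (n - 1)" "z_minus c (n - 1) < z (n - 1)"
    using assms(1) by (simp_all add: branch_le_iff branch_less_iff)
qed

text \<open>The ceiling of \<open>1 / x\<close> determines the index of the interval containing
  \<open>x\<close>, so the unions defining the fibre maps reduce to a single index.\<close>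

lemma mem_UN_pieces_iff:
  assumes "2 \<le> n" "z n \<le> x" "x < z (n - 1)"
    and "\<And>m. 2 \<le> m \<Longrightarrow> A m \<subseteq> {z m..<z (m - 1)}"
  shows "x \<in> (\<Union>m\<in>{2..}. A m) \<longleftrightarrow> x \<in> A n"
proof
  assume "x \<in> (\<Union>m\<in>{2..}. A m)"
  then obtain m where m: "2 \<le> m" "x \<in> A m"
    by auto
  then have "\<lceil>1 / x\<rceil> = int m"
    using assms(4)[OF m(1)] by (intro ceiling_inverse_eq) auto
  then show "x \<in> A n"
    using ceiling_inverse_eq[OF assms(1-3)] m by simp
qed (use assms(1) in auto)

lemma T_0_eq_branch:
  assumes n: "2 \<le> n" "z n \<le> x" "x < z (n - 1)" and c: "0 < c" "c \<le> 1"
  shows "T_0 c x = (if x < z_plus c n then 1 - branch n x else branch n x)"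
proof -
  have le: "z m \<le> z_plus c m \<and> z_plus c m \<le> z (m - 1)" if "2 \<le> m" for m
    using z_le_z_plus[OF that, of c] c by simp
  have "x \<in> (\<Union>m\<in>{2..}. {z m..<z_plus c m}) \<longleftrightarrow> x \<in> {z n..<z_plus c n}"
    by (rule mem_UN_pieces_iff[OF n], drule le) auto
  moreover have "x \<in> (\<Union>m\<in>{2..}. {z_plus c m..<z (m - 1)}) \<longleftrightarrow> x \<in> {z_plus c n..<z (n - 1)}"
    by (rule mem_UN_pieces_iff[OF n], drule le) auto
  \<comment> \<open>The two pieces of index \<open>n\<close> fill \<open>{z n..<z (n - 1)}\<close>,
    so the value \<open>undefined\<close> is not reached.\<close>
  ultimately show ?thesis
    unfolding T_0_def T_A_def Un_iff using n T_L_eq_branch[OF n] by simp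
qed

lemma T_1_eq_branch:
  assumes n: "2 \<le> n" "z n \<le> x" "x < z (n - 1)" and c: "0 < c" "c \<le> 1"
  shows "T_1 c x = (if x \<le> z_minus c (n - 1) then 1 - branch n x else branch n x)"
proof -
  have le: "z m \<le> z_minus c (m - 1) \<and> z_minus c (m - 1) < z (m - 1)" if "2 \<le> m" for m
    using z_le_z_minus[OF that, of c] c by simp
  have "x \<in> (\<Union>m\<in>{2..}. {z m..z_minus c (m - 1)}) \<longleftrightarrow> x \<in> {z n..z_minus c (n - 1)}"
    by (rule mem_UN_pieces_iff[OF n], drule le) auto
  moreover have "x \<in> (\<Union>m\<in>{2..}. {z_minus c (m - 1)<..<z (m - 1)}) \<longleftrightarrow>
      x \<in> {z_minus c (n - 1)<..<z (n - 1)}"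
    by (rule mem_UN_pieces_iff[OF n], drule le) auto
  ultimately show ?thesis
    unfolding T_1_def T_A_def Un_iff using n T_L_eq_branch[OF n] by simp
qed

section \<open>Images of open intervals under affine maps\<close>

lemma affine_image_greaterThanLessThan:
  fixes m q l r :: real
  assumes "m \<noteq> 0" "l < r"
  shows "(\<lambda>x. m * x + q) ` {l<..<r} = {min (m * l + q) (m * r + q)<..<max (m * l + q) (m * r + q)}"
    (is "?f ` _ = {?u<..<?v}")
proof -
  have iff: "?f x \<in> {?u<..<?v} \<longleftrightarrow> x \<in> {l<..<r}" for x
  proof (cases "0 < m")
    case True
    then have "m * l < m * r" using assms by simp
    then have "?u = m * l + q" "?v = m * r + q" by simp_all
    then show ?thesis using True by simp
  next
    case False
    then have "m < 0" "m * r < m * l" using assms by simp_all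
    then have "?u = m * r + q" "?v = m * l + q" by simp_all
    then show ?thesis using \<open>m < 0\<close> by auto
  qed
  have inv: "y = ?f ((y - q) / m)" for y
    using assms(1) by simp
  show ?thesis
  proof (rule set_eqI, rule iffI)
    fix y assume "y \<in> {?u<..<?v}"
    then have "(y - q) / m \<in> {l<..<r}"
      using iff inv by metis
    then show "y \<in> ?f ` {l<..<r}"
      using inv by (rule image_eqI[rotated])
  next
    fix y assume "y \<in> ?f ` {l<..<r}"
    then show "y \<in> {?u<..<?v}"
      using iff by blast
  qed
qed

text \<open>Reduces the Markov condition on one interval to two endpoint values. These are values of
  the affine formula, not of \<open>f\<close>, so a jump of \<open>f\<close> at an endpoint does no
  harm.\<close>

lemma markov_piece:
  fixes l r :: real and f :: "real \<Rightarrow> real"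
  assumes f: "\<And>x. x \<in> {l<..<r} \<Longrightarrow> f x = m * x + q" and "m \<noteq> 0" "l < r"
    and "m * l + q \<in> A" "m * r + q \<in> A"
  shows "(\<exists>m q. m \<noteq> 0 \<and> (\<forall>x\<in>{l<..<r}. f x = m * x + q)) \<and>
    (\<exists>u\<in>A. \<exists>v\<in>A. u < v \<and> f ` {l<..<r} = {u<..<v})"
proof -
  have "f ` {l<..<r} = (\<lambda>x. m * x + q) ` {l<..<r}"
    using f by (rule image_cong[OF refl])
  then have "f ` {l<..<r} = {min (m * l + q) (m * r + q)<..<max (m * l + q) (m * r + q)}"
    unfolding affine_image_greaterThanLessThan[OF assms(2,3)] .
  moreover have "m * l \<noteq> m * r"
    using assms(2,3) by simp
  then have "min (m * l + q) (m * r + q) < max (m * l + q) (m * r + q)"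
    by linarith
  moreover have "min (m * l + q) (m * r + q) \<in> A" "max (m * l + q) (m * r + q) \<in> A"
    using assms(4,5) by (auto simp: min_def max_def)
  ultimately have "\<exists>u\<in>A. \<exists>v\<in>A. u < v \<and> f ` {l<..<r} = {u<..<v}"
    by blast
  moreover have "\<exists>m q. m \<noteq> 0 \<and> (\<forall>x\<in>{l<..<r}. f x = m * x + q)"
    using f assms(2) by blast
  ultimately show ?thesis
    by (rule conjI[rotated])
qed

section \<open>The grid partition\<close>

lemma Ints_gap:
  fixes x k :: real
  assumes "x \<in> \<int>" "k \<in> \<int>"
  shows "x \<le> k \<or> k + 1 \<le> x"
proof -
  obtain i j :: int where ij: "x = of_int i" "k = of_int j"
    using assms by (auto elim!: Ints_cases)
  have "i \<le> j \<or> j + 1 \<le> i"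
    by linarith
  then have "real_of_int i \<le> real_of_int j \<or> real_of_int (j + 1) \<le> real_of_int i"
    unfolding of_int_le_iff .
  then show ?thesis
    unfolding ij of_int_add of_int_1 .
qed

text \<open>Separates the dynamics from the arithmetic of \<open>c\<close>: \<open>M\<close> is any
  common denominator of 1, \<open>c\<close> and the endpoints of the branches that reach beyond
  \<open>c\<close>.\<close>

lemma markov_random_luroth_grid:
  fixes c M :: real
  assumes c: "0 < c" "c \<le> 1 / 2" and M: "0 < M" "M \<in> \<int>" and cM: "M * c \<in> \<int>"
    and ends: "\<And>n. 2 \<le> n \<Longrightarrow> z (n - 1) > c \<Longrightarrow>
      M * z n \<in> \<int> \<and> M * z (n - 1) \<in> \<int> \<and> M * z_plus c n \<in> \<int> \<and> M * z_minus c (n - 1) \<in> \<int>"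
  shows "markov (random_luroth c p)"
proof -
  \<comment> \<open>\<open>M * (1 - c)\<close> is an integer, so the floor is exact and the last
    grid point is 1.\<close>
  define N where "N = nat \<lfloor>M * (1 - c)\<rfloor>"
  define a where "a i = c + real i / M" for i
  have N: "real N = M * (1 - c)"
  proof -
    have "M * (1 - c) \<in> \<int>" using M cM by (simp add: right_diff_distrib)
    then show ?thesis using M c by (auto simp: N_def elim!: Ints_cases)
  qed
  define A where "A = a ` {0..N}"
  have grid: "M * u \<in> \<int> \<Longrightarrow> c \<le> u \<Longrightarrow> u \<le> 1 \<Longrightarrow> u \<in> A" for u
  proof -
    assume u: "M * u \<in> \<int>" "c \<le> u" "u \<le> 1"
    have "M * (u - c) \<in> \<int>" using u(1) cM by (simp add: right_diff_distrib)
    then obtain k where k: "M * (u - c) = of_int k" by (auto elim: Ints_cases)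
    have "0 \<le> M * (u - c)" "M * (u - c) \<le> M * (1 - c)" using M u by simp_all
    then have "0 \<le> k" and "real (nat k) \<le> real N" using k N by auto
    moreover from \<open>0 \<le> k\<close> have "u = a (nat k)" using k M by (simp add: a_def field_simps)
    ultimately show "u \<in> A" by (simp add: A_def)
  qed
  have piece: "(\<exists>m q. m \<noteq> 0 \<and> (\<forall>x\<in>{a i<..<a (Suc i)}. fibre (random_luroth c p) j x = m * x + q)) \<and>
      (\<exists>u\<in>A. \<exists>v\<in>A. u < v \<and> fibre (random_luroth c p) j ` {a i<..<a (Suc i)} = {u<..<v})"
    if i: "i < N" for i j
  proof -
    define l r where "l = a i" and "r = a (Suc i)"
    have lr: "l < r" "c \<le> l" "r \<le> 1"
    proof -
      show "l < r" "c \<le> l" using M by (auto simp: l_def r_def a_def divide_strict_right_mono)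
      have "real (Suc i) \<le> M * (1 - c)" using i N by (metis Suc_leI of_nat_le_iff)
      then show "r \<le> 1" using M by (simp add: r_def a_def field_simps)
    qed
    have Ml: "M * l \<in> \<int>" and Mr: "M * r = M * l + 1"
      using M cM by (auto simp: l_def r_def a_def distrib_left add_divide_distrib)
    have gap: "u \<le> l \<or> r \<le> u" if "M * u \<in> \<int>" for u
    proof -
      have "M * u \<le> M * l \<or> M * r \<le> M * u" using Ints_gap[OF that Ml] Mr by simp
      then show ?thesis using M by simp
    qed
    \<comment> \<open>The ceiling assigns a left endpoint \<open>l = 1 / k\<close> to branch
      \<open>k\<close>, the one to the right of \<open>l\<close>.\<close>
    define n where "n = nat \<lceil>1 / l\<rceil>"
    have "0 < l" "l < 1" using lr c by auto
    then have "1 < 1 / l" by simp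
    then have n: "2 \<le> n" "1 / l \<le> real n" "real n - 1 < 1 / l"
      unfolding n_def by linarith+
    have zn: "z n \<le> l" "l < z (n - 1)"
      using n \<open>0 < l\<close> by (auto simp: z_def of_nat_diff field_simps)
    note B = branch_endpoints[OF n(1)]
    have E: "M * z (n - 1) \<in> \<int>" "M * z_plus c n \<in> \<int>" "M * z_minus c (n - 1) \<in> \<int>"
      using ends[OF n(1)] zn lr by auto
    have zr: "r \<le> z (n - 1)" using gap[OF E(1)] zn by auto
    have c1: "c \<le> 1" using c by simp
    note le = branch_le_iff[OF n(1)]
    have b01: "0 \<le> branch n l" "branch n r \<le> 1" "branch n l \<le> branch n r"
      using zn zr lr B by (metis le less_imp_le)+
    have bI: "M * branch n x \<in> \<int>" if "M * x \<in> \<int>" for x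
    proof -
      have "M * branch n x = real n * (real n - 1) * (M * x) - M * (real n - 1)"
        by (simp add: branch_def algebra_simps)
      also have "\<dots> \<in> \<int>" using that M by simp
      finally show ?thesis .
    qed
    have MrI: "M * r \<in> \<int>" using Ml Mr by simp
    \<comment> \<open>Endpoint values are multiples of \<open>1 / M\<close>; what remains is that
      they lie in \<open>[c,1]\<close>. The smaller one decides: \<open>branch n l\<close> here,
      \<open>1 - branch n r\<close> after the flip.\<close>
    have direct: "branch n l \<in> A" "branch n r \<in> A" if "c \<le> branch n l"
      using that b01 Ml MrI bI by (auto intro!: grid)
    have flipped: "1 - branch n l \<in> A" "1 - branch n r \<in> A" if "branch n r \<le> 1 - c"
    proof -
      have "M * (1 - branch n l) \<in> \<int>" "M * (1 - branch n r) \<in> \<int>"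
        unfolding right_diff_distrib using Ml MrI bI M(2) by simp_all
      then show "1 - branch n l \<in> A" "1 - branch n r \<in> A"
        using that b01 by (auto intro!: grid)
    qed
    have slope: "real n * (real n - 1) \<noteq> 0" using n(1) by auto
    have branch_affine: "branch n x = real n * (real n - 1) * x + (1 - real n)" for x
      by (simp add: branch_def)
    define good where "good f \<longleftrightarrow> (\<exists>m q. m \<noteq> 0 \<and> (\<forall>x\<in>{l<..<r}. f x = m * x + q)) \<and>
        (\<exists>u\<in>A. \<exists>v\<in>A. u < v \<and> f ` {l<..<r} = {u<..<v})" for f :: "real \<Rightarrow> real"
    have good_direct: "good f" if f: "\<And>x. x \<in> {l<..<r} \<Longrightarrow> f x = branch n x" and "c \<le> branch n l"
      for f
      unfolding good_def
      by (rule markov_piece[where m = "real n * (real n - 1)" and q = "1 - real n"])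
        (use f slope lr direct[OF that(2)] in \<open>simp_all add: branch_affine\<close>)
    have good_flipped: "good f"
      if f: "\<And>x. x \<in> {l<..<r} \<Longrightarrow> f x = 1 - branch n x" and "branch n r \<le> 1 - c" for f
      unfolding good_def
      by (rule markov_piece[where m = "- (real n * (real n - 1))" and q = "real n"])
        (use f slope lr flipped[OF that(2)] in \<open>simp_all add: branch_affine\<close>)
    have T0: "T_0 c x = (if x < z_plus c n then 1 - branch n x else branch n x)"
      and T1: "T_1 c x = (if x \<le> z_minus c (n - 1) then 1 - branch n x else branch n x)"
      if "x \<in> {l<..<r}" for x
      using T_0_eq_branch[OF n(1) _ _ c(1) c1, of x] T_1_eq_branch[OF n(1) _ _ c(1) c1, of x]
        that zn zr by auto
    \<comment> \<open>\<open>T_0\<close> switches at height \<open>c\<close> and \<open>T_1\<close>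
      at height \<open>1 - c\<close>. As \<open>c \<le> 1 - c\<close>, flipping below
      \<open>c\<close> and not flipping above \<open>1 - c\<close> both keep values at least
      \<open>c\<close>; the other two cases fit directly.\<close>
    have "good (T_0 c)"
      using gap[OF E(2)]
    proof
      assume h: "z_plus c n \<le> l"
      then have "c \<le> branch n l" using le B(3) by metis
      then show ?thesis using h T0 by (intro good_direct) auto
    next
      assume h: "r \<le> z_plus c n"
      then have "branch n r \<le> c" using le B(3) by metis
      then show ?thesis using h T0 c by (intro good_flipped) auto
    qed
    moreover have "good (T_1 c)"
      using gap[OF E(3)]
    proof
      assume h: "z_minus c (n - 1) \<le> l"
      then have "1 - c \<le> branch n l" using le B(4) by metis
      then show ?thesis using h T1 c by (intro good_direct) auto
    next
      assume h: "r \<le> z_minus c (n - 1)"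
      then have "branch n r \<le> 1 - c" using le B(4) by metis
      then show ?thesis using h T1 by (intro good_flipped) auto
    qed
    ultimately have "good (fibre (random_luroth c p) j)"
      by (simp add: random_luroth_def)
    then show ?thesis
      unfolding good_def l_def r_def .
  qed
  have "markov_partition (random_luroth c p) N a"
    unfolding markov_partition_def A_def[symmetric]
  proof (intro conjI ballI allI impI piece[THEN conjunct1] piece[THEN conjunct2])
    show "a 0 = lower (random_luroth c p)" "a N = upper (random_luroth c p)"
      using M N by (simp_all add: a_def random_luroth_def)
    show "a i < a (Suc i)" for i
      using M by (simp add: a_def divide_strict_right_mono)
  qed
  then show ?thesis
    unfolding markov_def by blast
qed

section \<open>A common denominator for rational \<open>c\<close>\<close>

lemma real_divide_Ints: "d dvd k \<Longrightarrow> real k / real d \<in> \<int>"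
  by (simp flip: real_of_nat_div)

theorem proposition5p1:
  fixes c p :: real
  assumes "c \<in> \<rat>" and "0 < c" and "c \<le> 1 / 2"
    and "0 < p" and "p < 1"
  shows "markov (random_luroth c p)"
proof -
  obtain a b :: nat where b: "b \<noteq> 0" and "\<bar>c\<bar> = real a / real b"
    by (rule Rats_abs_nat_div_natE[OF \<open>c \<in> \<rat>\<close>])
  then have ab: "c = real a / real b"
    using \<open>0 < c\<close> by simp
  have a: "1 \<le> a" using ab \<open>0 < c\<close> by (cases a) auto
  \<comment> \<open>The factor \<open>b\<close> cancels the denominator of \<open>c\<close>; the
    remaining \<open>fact b\<close> absorbs \<open>n * (n - 1)\<close> for every
    \<open>n \<le> b\<close>, even in the offset \<open>c * z n * z (n - 1)\<close>.\<close>
  define M where "M = real (b * fact b)"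
  have cM: "M * c = real (a * fact b)" using b by (simp add: M_def ab)
  show ?thesis
  proof (rule markov_random_luroth_grid[where M = M])
    show "0 < M" using b by (simp add: M_def)
    show "M \<in> \<int>" "M * c \<in> \<int>" unfolding cM unfolding M_def by (rule Ints_of_nat)+
    fix n :: nat assume n: "2 \<le> n" "c < z (n - 1)"
    \<comment> \<open>As \<open>a \<ge> 1\<close>, a branch reaching beyond \<open>c\<close>
      satisfies \<open>1 / b < 1 / (n - 1)\<close>, which bounds its index by
      \<open>b\<close>.\<close>
    have "1 / real b \<le> c" using a b by (simp add: ab divide_right_mono)
    then have "1 / real b < 1 / real (n - 1)" using n by (simp add: z_def)
    then have "n - 1 < b" using n b by (simp add: field_simps)
    then have "n \<le> b" by simp
    then have "fact n dvd (fact b :: nat)" by (rule fact_dvd)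
    moreover have "n * (n - 1) dvd fact n"
      using n fact_reduce[of n, where ?'a = nat] dvd_fact[of "n - 1" "n - 1"] by auto
    ultimately have d: "n * (n - 1) dvd fact b" by (rule dvd_trans[rotated])
    then have "n dvd b * fact b" "n - 1 dvd b * fact b"
      by (meson dvd_mult dvd_mult_left dvd_mult_right)+
    then have I: "M * z n \<in> \<int>" "M * z (n - 1) \<in> \<int>"
      using real_divide_Ints by (simp_all add: M_def z_def del: of_nat_mult)
    have "M * (c * z n * z (n - 1)) = real (a * fact b) / real (n * (n - 1))"
      unfolding cM[symmetric] by (simp add: z_def)
    then have J: "M * (c * z n * z (n - 1)) \<in> \<int>"
      using real_divide_Ints[OF dvd_mult[OF d]] by simp
    have "M * z_plus c n = M * z n + M * (c * z n * z (n - 1))"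
      by (simp add: z_plus_def distrib_left)
    moreover have "M * z_minus c (n - 1) = M * z (n - 1) - M * (c * z n * z (n - 1))"
      using n by (simp add: z_minus_def right_diff_distrib mult_ac)
    ultimately show "M * z n \<in> \<int> \<and> M * z (n - 1) \<in> \<int> \<and> M * z_plus c n \<in> \<int> \<and>
        M * z_minus c (n - 1) \<in> \<int>"
      using I J by simp
  qed (use assms in auto)
qed

end
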